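(* Let $2<q<\infty$ and let $\alpha\in\mathbb R$ with $|\alpha|\le\frac12$. Suppose that $(q+2)\alpha^2>1$. Then the function $r\equiv 1$ cannot provide the minimal value in the problem $$J(r,\varphi)=\int_0^{2\pi}\bigl(r'^2+r^2\varphi'^2\bigr)\,dx\ \to\ \min,\qquad \int_0^{2\pi}r^q\,dx=2\pi,\qquad \int_0^{2\pi}\varphi'\,dx=2\pi\alpha$$ (i.e. no admissible pair $(r,\varphi)$ with $r\equiv1$ is a minimizer of $J$ over admissible pairs), and thus $$\mu_q(\alpha)<(2\pi)^{\frac12-\frac1q}\,|\alpha|.$$
   Context: For $2<q<\infty$ and real $\alpha$, define $$\mu_q(\alpha)=\min_u\frac{\|u'+i\alpha u\|_{L_2(0,2\pi)}}{\|u\|_{L_q(0,2\pi)}},$$ where the minimum is over all complex-valued $2\pi$-periodic absolutely continuous functions $u\not\equiv0$ (the minimum is attained). Normalizing $\|u\|_{L_q}^q=2\pi$ and writing $r=|u|$, $\varphi=\arg(u)+\alpha x$, one has $\int_0^{2\pi}|u'+i\alpha u|^2dx=J(r,\varphi)$. Admissible pairs $(r,\varphi)$ in the minimization problem for $J$ consist of a positive $2\pi$-periodic absolutely continuous function $r$ and a real-valued locally absolutely continuous function $\varphi$ such that $\varphi'$ is $2\pi$-periodic, $\int_0^{2\pi}\varphi'\,dx=2\pi\alpha$ and $\int_0^{2\pi}r^q\,dx=2\pi$. *)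

theory Defs
  imports "HOL-Analysis.Analysis"
begin

definition absolutely_continuous_on :: "real set \<Rightarrow> (real \<Rightarrow> 'a::real_normed_vector) \<Rightarrow> bool"
  where "absolutely_continuous_on S f \<longleftrightarrow>
    (\<forall>\<epsilon>>0. \<exists>\<delta>>0. \<forall>D :: (real \<times> real) set.
       finite D \<longrightarrow> (\<forall>(a,b)\<in>D. a \<le> b \<and> {a..b} \<subseteq> S) \<longrightarrow>
       disjoint_family_on (\<lambda>(a,b). {a<..<b}) D \<longrightarrow>
       (\<Sum>(a,b)\<in>D. b - a) < \<delta> \<longrightarrow> (\<Sum>(a,b)\<in>D. norm (f b - f a)) < \<epsilon>)"

definition locally_absolutely_continuous :: "(real \<Rightarrow> 'a::real_normed_vector) \<Rightarrow> bool"
  where "locally_absolutely_continuous f \<longleftrightarrow> (\<forall>a b. absolutely_continuous_on {a..b} f)"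

definition periodic_2pi :: "(real \<Rightarrow> 'a) \<Rightarrow> bool"
  where "periodic_2pi f \<longleftrightarrow> (\<forall>x. f (x + 2 * pi) = f x)"

abbreviation period_measure :: "real measure"
  where "period_measure \<equiv> lebesgue_on {0..2 * pi}"

text \<open>
  Derivatives of absolutely continuous functions exist only almost everywhere; the arbitrary
  value that \<^const>\<open>deriv\<close> and \<^const>\<open>vector_derivative\<close> take elsewhere affects none of the
  integrals below, because Lebesgue measure is complete. Norms and energies are
  extended-nonnegative: the derivative of an absolutely continuous function need not be
  square integrable, in which case the quantity is \<open>\<infinity>\<close>.
\<close>

definition Lp_norm :: "real \<Rightarrow> (real \<Rightarrow> complex) \<Rightarrow> ennreal"
  where "Lp_norm p f =
    (let I = (\<integral>\<^sup>+x. ennreal (norm (f x) powr p) \<partial>period_measure)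
     in if I = \<infinity> then \<infinity> else ennreal (enn2real I powr (1 / p)))"

definition mu_admissible :: "(real \<Rightarrow> complex) \<Rightarrow> bool"
  where "mu_admissible u \<longleftrightarrow>
    periodic_2pi u \<and> absolutely_continuous_on {0..2 * pi} u \<and> (\<exists>x. u x \<noteq> 0)"

text \<open>
  Written as an infimum, which makes sense without knowing that it is attained and equals the
  minimum when it is. The denominator is positive and finite for every competitor.
\<close>

definition mu :: "real \<Rightarrow> real \<Rightarrow> ennreal"
  where "mu q \<alpha> =
    (INF u\<in>{u. mu_admissible u}.
       Lp_norm 2 (\<lambda>x. vector_derivative u (at x) + \<i> * complex_of_real \<alpha> * u x) / Lp_norm q u)"

definition J :: "(real \<Rightarrow> real) \<Rightarrow> (real \<Rightarrow> real) \<Rightarrow> ennreal"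
  where "J r \<phi> =
    (\<integral>\<^sup>+x. ennreal ((deriv r x)\<^sup>2 + (r x)\<^sup>2 * (deriv \<phi> x)\<^sup>2) \<partial>period_measure)"

definition admissible :: "real \<Rightarrow> real \<Rightarrow> (real \<Rightarrow> real) \<Rightarrow> (real \<Rightarrow> real) \<Rightarrow> bool"
  where "admissible q \<alpha> r \<phi> \<longleftrightarrow>
    (\<forall>x. r x > 0) \<and> periodic_2pi r \<and> absolutely_continuous_on {0..2 * pi} r \<and>
    locally_absolutely_continuous \<phi> \<and>
    (AE x in lebesgue. deriv \<phi> (x + 2 * pi) = deriv \<phi> x) \<and>
    has_bochner_integral period_measure (deriv \<phi>) (2 * pi * \<alpha>) \<and>
    has_bochner_integral period_measure (\<lambda>x. r x powr q) (2 * pi)"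

definition J_minimizer :: "real \<Rightarrow> real \<Rightarrow> (real \<Rightarrow> real) \<Rightarrow> (real \<Rightarrow> real) \<Rightarrow> bool"
  where "J_minimizer q \<alpha> r \<phi> \<longleftrightarrow>
    admissible q \<alpha> r \<phi> \<and> (\<forall>s \<psi>. admissible q \<alpha> s \<psi> \<longrightarrow> J r \<phi> \<le> J s \<psi>)"

end

theory Submission
  imports Defs "HOL-Real_Asymp.Real_Asymp"
begin

text \<open>
  With \<open>r \<equiv> 1\<close> fixed, Cauchy--Schwarz shows that the energy is at least \<open>2\<pi>\<alpha>\<^sup>2\<close>
  (\<open>J_unit_radius_ge\<close>), with equality for \<open>\<phi> x = \<alpha> x\<close>. Everything therefore comes down to
  an admissible pair with energy strictly below \<open>2\<pi>\<alpha>\<^sup>2\<close>. The idea is to perturb the radius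
  and let the phase rotate more slowly where the radius is large:
  \<open>r = (1 + \<epsilon> cos x)\<^bsup>1/q\<^esup>\<close> and \<open>\<phi> = \<alpha> (x - (2\<epsilon>/q) sin x)\<close>, with \<open>\<epsilon> > 0\<close> small.
  Both constraints hold exactly, because \<open>r\<^sup>q = 1 + \<epsilon> cos x\<close> and
  \<open>\<phi>' = \<alpha> (1 - (2\<epsilon>/q) cos x)\<close>; no renormalization is needed. The phase agrees to first
  order in \<open>\<epsilon>\<close> with the optimal one, for which \<open>r\<^sup>2 \<phi>'\<close> is constant.

  Put \<open>y = \<epsilon> cos x\<close> and \<open>p = 2/q\<close>. The energy density is
  \<open>q\<^sup>-\<^sup>2 \<epsilon>\<^sup>2 sin\<^sup>2 x (1+y)\<^bsup>p-2\<^esup> + \<alpha>\<^sup>2 (1+y)\<^sup>p (1-py)\<^sup>2\<close>,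
  and \<open>(1+y)\<^sup>p (1-py)\<^sup>2 = 1 - py - (p+p\<^sup>2)/2 y\<^sup>2 + o(y\<^sup>2)\<close>. The linear term integrates to zero,
  and \<open>sin\<^sup>2\<close> and \<open>cos\<^sup>2\<close> both integrate to \<open>\<pi>\<close> over a period, so the energy is
  \<open>2\<pi>\<alpha>\<^sup>2 + (\<pi>\<epsilon>\<^sup>2/q\<^sup>2) (1 - (q+2)\<alpha>\<^sup>2) + o(\<epsilon>\<^sup>2)\<close>,
  which is below \<open>2\<pi>\<alpha>\<^sup>2\<close> for small \<open>\<epsilon>\<close> as soon as
  \<open>(q+2)\<alpha>\<^sup>2 > 1\<close> (\<open>exists_lower_energy_test_pair\<close>).

  For \<open>\<mu>\<close>, the complex function \<open>u = r exp(i(\<phi> - \<alpha>x))\<close> is periodic, and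
  \<open>|u' + i\<alpha>u|\<^sup>2 = r'\<^sup>2 + r\<^sup>2\<phi>'\<^sup>2\<close>; hence the low energy of the test pair turns into a
  small quotient (\<open>mu_le_of_polar_pair\<close>).
\<close>

section \<open>Absolute continuity and integrals of smooth functions\<close>

lemma absolutely_continuous_on_lipschitz:
  assumes f: "B-lipschitz_on S f"
  shows "absolutely_continuous_on S f"
  unfolding absolutely_continuous_on_def
proof (intro allI impI)
  fix e :: real assume e: "e > 0"
  \<comment> \<open>The Lipschitz constant may be 0, so it is enlarged before dividing by it.\<close>
  define C where "C = B + 1"
  have C: "C > 0" "B \<le> C" using lipschitz_on_nonneg[OF f] unfolding C_def by auto
  show "\<exists>\<delta>>0. \<forall>D :: (real \<times> real) set.
       finite D \<longrightarrow> (\<forall>(a,b)\<in>D. a \<le> b \<and> {a..b} \<subseteq> S) \<longrightarrow>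
       disjoint_family_on (\<lambda>(a,b). {a<..<b}) D \<longrightarrow>
       (\<Sum>(a,b)\<in>D. b - a) < \<delta> \<longrightarrow> (\<Sum>(a,b)\<in>D. norm (f b - f a)) < e"
  proof (intro exI[of _ "e / C"] conjI allI impI)
    show "e / C > 0" using e C by simp
    fix D :: "(real \<times> real) set"
    assume D: "\<forall>(a,b)\<in>D. a \<le> b \<and> {a..b} \<subseteq> S" and less: "(\<Sum>(a,b)\<in>D. b - a) < e / C"
    have "(\<Sum>(a,b)\<in>D. norm (f b - f a)) \<le> (\<Sum>(a,b)\<in>D. C * (b - a))"
    proof (rule sum_mono, clarify)
      fix a b assume "(a, b) \<in> D"
      then have ab: "a \<le> b" "a \<in> S" "b \<in> S" using D by fastforce+
      have "norm (f b - f a) \<le> B * (b - a)" using lipschitz_onD[OF f, of b a] ab by (simp add: dist_norm)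
      also have "\<dots> \<le> C * (b - a)" using C ab by (intro mult_right_mono) auto
      finally show "norm (f b - f a) \<le> C * (b - a)" .
    qed
    also have "\<dots> = C * (\<Sum>(a,b)\<in>D. b - a)"
      by (simp add: sum_distrib_left case_prod_unfold)
    also have "\<dots> < e" using less C by (simp add: field_simps)
    finally show "(\<Sum>(a,b)\<in>D. norm (f b - f a)) < e" .
  qed
qed

lemma absolutely_continuous_on_C1:
  assumes f: "\<And>x. (f has_vector_derivative f' x) (at x)" and "continuous_on {a..b} f'"
  shows "absolutely_continuous_on {a..b} f"
proof -
  have "bounded (f' ` {a..b})"
    using assms(2) by (intro compact_imp_bounded compact_continuous_image) auto
  then obtain B where B: "\<And>x. x \<in> {a..b} \<Longrightarrow> norm (f' x) \<le> B"
    unfolding bounded_iff by blast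
  have "\<bar>B\<bar>-lipschitz_on {a..b} f"
  proof (rule bounded_derivative_imp_lipschitz)
    fix x assume x: "x \<in> {a..b}"
    show "(f has_derivative (\<lambda>h. h *\<^sub>R f' x)) (at x within {a..b})"
      using f[of x] by (simp add: has_vector_derivative_def has_derivative_at_withinI)
    show "onorm (\<lambda>h. h *\<^sub>R f' x) \<le> \<bar>B\<bar>"
      using B[OF x] by (intro onorm_bound)
        (auto simp: mult.commute[of "\<bar>B\<bar>"] intro!: mult_left_mono)
  qed auto
  then show ?thesis by (rule absolutely_continuous_on_lipschitz)
qed

lemma has_bochner_integral_lebesgue_on_continuous:
  fixes f :: "real \<Rightarrow> real"
  assumes "continuous_on {a..b} f" "(f has_integral I) {a..b}"
  shows "has_bochner_integral (lebesgue_on {a..b}) f I"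
proof -
  have "integrable (lebesgue_on {a..b}) f" using assms(1) by (rule continuous_imp_integrable_real)
  moreover from this have "integral\<^sup>L (lebesgue_on {a..b}) f = I"
    using assms(2) by (subst lebesgue_integral_eq_integral) (auto simp: integral_unique)
  ultimately show ?thesis by (simp add: has_bochner_integral_iff)
qed

section \<open>The energy with constant radius\<close>

text \<open>
  Cauchy--Schwarz in the form \<open>\<phi>'\<^sup>2 \<ge> 2\<alpha>\<phi>' - \<alpha>\<^sup>2\<close>, the tangent-line bound at the mean of
  \<open>\<phi>'\<close>. It avoids a case distinction on whether \<open>\<phi>'\<close> is square integrable; the positive part
  is inserted because the lower bound can be negative, while \<^const>\<open>nn_integral\<close> only sees
  nonnegative values.
\<close>
lemma J_unit_radius_ge:
  assumes "has_bochner_integral period_measure (deriv \<phi>) (2 * pi * \<alpha>)"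
  shows "ennreal (2 * pi * \<alpha>\<^sup>2) \<le> J (\<lambda>x. 1) \<phi>"
proof -
  let ?g = "\<lambda>x. 2 * \<alpha> * deriv \<phi> x - \<alpha>\<^sup>2"
  have int: "integrable period_measure (deriv \<phi>)"
    and val: "integral\<^sup>L period_measure (deriv \<phi>) = 2 * pi * \<alpha>"
    using assms by (auto simp: has_bochner_integral_iff)
  have const: "has_bochner_integral period_measure (\<lambda>x. \<alpha>\<^sup>2) (2 * pi * \<alpha>\<^sup>2)"
    using has_integral_const_real[of "\<alpha>\<^sup>2" 0 "2 * pi"]
    by (intro has_bochner_integral_lebesgue_on_continuous) auto
  have g: "integrable period_measure ?g"
    using int const by (auto simp: has_bochner_integral_iff)
  have "integral\<^sup>L period_measure ?g
      = 2 * \<alpha> * integral\<^sup>L period_measure (deriv \<phi>) - integral\<^sup>L period_measure (\<lambda>x. \<alpha>\<^sup>2)"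
    using int const by (simp add: has_bochner_integral_iff)
  then have "2 * pi * \<alpha>\<^sup>2 = integral\<^sup>L period_measure ?g"
    unfolding val has_bochner_integral_integral_eq[OF const] by (simp add: power2_eq_square)
  also have "\<dots> \<le> integral\<^sup>L period_measure (\<lambda>x. max 0 (?g x))"
    using g by (intro integral_mono) auto
  finally have "ennreal (2 * pi * \<alpha>\<^sup>2) \<le> ennreal (integral\<^sup>L period_measure (\<lambda>x. max 0 (?g x)))"
    by (rule ennreal_leI)
  also have "\<dots> = (\<integral>\<^sup>+x. ennreal (max 0 (?g x)) \<partial>period_measure)"
    using g by (intro nn_integral_eq_integral[symmetric]) auto
  also have "\<dots> \<le> J (\<lambda>x. 1) \<phi>"
    unfolding J_def
  proof (intro nn_integral_mono ennreal_leI)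
    fix x
    have "0 \<le> (deriv \<phi> x - \<alpha>)\<^sup>2" by simp
    then show "max 0 (?g x) \<le> (deriv (\<lambda>x. 1) x)\<^sup>2 + 1\<^sup>2 * (deriv \<phi> x)\<^sup>2"
      by (simp add: power2_diff algebra_simps)
  qed
  finally show ?thesis .
qed

section \<open>From polar pairs to the quotient\<close>

text \<open>
  The competitor is \<open>u = r exp(i(\<phi> - \<alpha>x))\<close>. It is periodic because \<open>\<phi>\<close> gains exactly
  \<open>2\<pi>\<alpha>\<close> over a period, and multiplying \<open>u' + i\<alpha>u\<close> by the unimodular
  \<open>exp(-i(\<phi> - \<alpha>x))\<close> leaves \<open>r' + i r \<phi>'\<close>.
\<close>
lemma mu_le_of_polar_pair:
  assumes q: "q > 0"
    and r: "\<And>x. (r has_real_derivative r' x) (at x)" "continuous_on UNIV r'"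
    and \<phi>: "\<And>x. (\<phi> has_real_derivative \<phi>' x) (at x)" "continuous_on UNIV \<phi>'"
    and pos: "\<And>x. r x > 0"
    and per: "periodic_2pi r" "\<And>x. \<phi> (x + 2 * pi) = \<phi> x + 2 * pi * \<alpha>"
    and norm: "has_bochner_integral period_measure (\<lambda>x. r x powr q) (2 * pi)"
    and B: "J r \<phi> \<le> ennreal B" "B \<ge> 0"
  shows "mu q \<alpha> \<le> ennreal (sqrt B / (2 * pi) powr (1 / q))"
proof -
  define u where "u = (\<lambda>x. of_real (r x) * cis (\<phi> x - \<alpha> * x))"
  define u' where "u' = (\<lambda>x. of_real (r' x) * cis (\<phi> x - \<alpha> * x)
     + of_real (r x) * (of_real (\<phi>' x - \<alpha>) * (\<i> * cis (\<phi> x - \<alpha> * x))))"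
  have u': "(u has_vector_derivative u' x) (at x)" for x
  proof -
    have "((\<lambda>x. \<i> * of_real (\<phi> x - \<alpha> * x)) has_vector_derivative \<i> * of_real (\<phi>' x - \<alpha>)) (at x)"
      by (intro has_vector_derivative_mult_right has_vector_derivative_of_real)
        (auto intro!: derivative_eq_intros \<phi> simp flip: has_real_derivative_iff_has_vector_derivative)
    from field_vector_diff_chain_at[OF this DERIV_exp]
    have "((\<lambda>x. cis (\<phi> x - \<alpha> * x)) has_vector_derivative
        of_real (\<phi>' x - \<alpha>) * (\<i> * cis (\<phi> x - \<alpha> * x))) (at x)"
      by (simp add: o_def cis_conv_exp mult_ac)
    moreover have "((\<lambda>x. complex_of_real (r x)) has_vector_derivative of_real (r' x)) (at x)"
      using r(1) by (intro has_vector_derivative_of_real)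
        (simp flip: has_real_derivative_iff_has_vector_derivative)
    ultimately show ?thesis
      unfolding u_def u'_def by (auto intro: derivative_eq_intros)
  qed
  have cr: "continuous_on UNIV r" "continuous_on UNIV \<phi>"
    using r(1) \<phi>(1) by (auto intro!: DERIV_isCont continuous_at_imp_continuous_on)
  have "continuous_on UNIV u'"
    unfolding u'_def by (intro continuous_intros cr r \<phi>)
  then have "absolutely_continuous_on {0..2 * pi} u"
    using u' by (intro absolutely_continuous_on_C1[of u u']) (auto intro: continuous_on_subset)
  moreover have "periodic_2pi u"
    using per unfolding periodic_2pi_def u_def by (simp add: algebra_simps)
  moreover have "u 0 \<noteq> 0" using pos[of 0] by (simp add: u_def)
  ultimately have adm: "mu_admissible u" unfolding mu_admissible_def by blast
  have energy: "(norm (vector_derivative u (at x) + \<i> * of_real \<alpha> * u x))\<^sup>2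
      = (deriv r x)\<^sup>2 + (r x)\<^sup>2 * (deriv \<phi> x)\<^sup>2" for x
  proof -
    have "vector_derivative u (at x) + \<i> * of_real \<alpha> * u x
      = Complex (r' x) (r x * \<phi>' x) * cis (\<phi> x - \<alpha> * x)"
      using vector_derivative_at[OF u'[of x]]
      by (simp add: u_def u'_def Complex_eq algebra_simps)
    then have "norm (vector_derivative u (at x) + \<i> * of_real \<alpha> * u x) = norm (Complex (r' x) (r x * \<phi>' x))"
      by (simp only: norm_mult norm_cis mult_1_right)
    then show ?thesis
      unfolding DERIV_imp_deriv[OF r(1)] DERIV_imp_deriv[OF \<phi>(1)]
      by (simp add: cmod_def power_mult_distrib)
  qed
  let ?I = "\<integral>\<^sup>+x. ennreal (norm (vector_derivative u (at x) + \<i> * of_real \<alpha> * u x) powr 2)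
    \<partial>period_measure"
  have I: "?I = J r \<phi>"
    unfolding J_def by (simp add: energy)
  have fin: "?I \<noteq> \<infinity>" using B(1) unfolding I by (auto simp: top_unique)
  have "enn2real ?I \<le> B"
    unfolding I using B by (metis enn2real_mono enn2real_ennreal ennreal_less_top)
  then have num: "Lp_norm 2 (\<lambda>x. vector_derivative u (at x) + \<i> * of_real \<alpha> * u x) \<le> ennreal (sqrt B)"
    using fin B by (auto simp: Lp_norm_def Let_def powr_half_sqrt intro!: ennreal_leI)
  have "(\<integral>\<^sup>+x. ennreal (norm (u x) powr q) \<partial>period_measure)
      = (\<integral>\<^sup>+x. ennreal (r x powr q) \<partial>period_measure)"
    using pos by (intro nn_integral_cong) (simp add: u_def norm_mult less_imp_le)
  also have "\<dots> = ennreal (2 * pi)"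
    using norm by (subst nn_integral_eq_integral) (auto simp: has_bochner_integral_iff)
  finally have den: "Lp_norm q u = ennreal ((2 * pi) powr (1 / q))"
    by (simp add: Lp_norm_def)
  have "mu q \<alpha> \<le> Lp_norm 2 (\<lambda>x. vector_derivative u (at x) + \<i> * of_real \<alpha> * u x) / Lp_norm q u"
    unfolding mu_def using adm by (intro INF_lower) auto
  also have "\<dots> \<le> ennreal (sqrt B) / ennreal ((2 * pi) powr (1 / q))"
    unfolding den using num by (rule divide_right_mono_ennreal)
  also have "\<dots> = ennreal (sqrt B / (2 * pi) powr (1 / q))"
    using B by (intro divide_ennreal) auto
  finally show ?thesis .
qed

section \<open>The perturbed pair\<close>

text \<open>
  The second-order Taylor expansions at \<open>y = 0\<close>, used as one-sided bounds in which \<open>\<delta>\<close>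
  absorbs the remainders.
\<close>
lemma energy_density_expansion:
  fixes p \<delta> :: real
  assumes "\<delta> > 0"
  obtains \<epsilon> where "0 < \<epsilon>" "\<epsilon> < 1"
    "\<And>y. \<bar>y\<bar> \<le> \<epsilon> \<Longrightarrow> (1 + y) powr (p - 2) \<le> 1 + \<delta>"
    "\<And>y. \<bar>y\<bar> \<le> \<epsilon> \<Longrightarrow> (1 + y) powr p * (1 - p * y)\<^sup>2 \<le> 1 - p * y - ((p + p\<^sup>2) / 2 - \<delta>) * y\<^sup>2"
proof -
  have "((\<lambda>y::real. (1 + y) powr (p - 2)) \<longlongrightarrow> 1) (at 0)"
    by real_asymp
  then have "\<forall>\<^sub>F y in at 0. (1 + y) powr (p - 2) < 1 + \<delta>"
    using assms by (intro order_tendstoD) auto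
  moreover have "((\<lambda>y::real. ((1 + y) powr p * (1 - p * y)\<^sup>2 - (1 - p * y - (p + p\<^sup>2) / 2 * y\<^sup>2)) / y\<^sup>2)
      \<longlongrightarrow> 0) (at 0)"
    by (real_asymp simp: field_simps power2_eq_square)
  then have "\<forall>\<^sub>F y in at 0.
      ((1 + y) powr p * (1 - p * y)\<^sup>2 - (1 - p * y - (p + p\<^sup>2) / 2 * y\<^sup>2)) / y\<^sup>2 < \<delta>"
    using assms by (intro order_tendstoD) auto
  ultimately have "\<forall>\<^sub>F y in at 0. (1 + y) powr (p - 2) \<le> 1 + \<delta> \<and>
     (1 + y) powr p * (1 - p * y)\<^sup>2 \<le> 1 - p * y - ((p + p\<^sup>2) / 2 - \<delta>) * y\<^sup>2"
    using eventually_neq_at_within[of 0 0 UNIV]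
    by eventually_elim (simp add: field_simps)
  then obtain d where d: "d > 0" and bd: "\<And>y. y \<noteq> 0 \<Longrightarrow> \<bar>y\<bar> < d \<Longrightarrow> (1 + y) powr (p - 2) \<le> 1 + \<delta> \<and>
     (1 + y) powr p * (1 - p * y)\<^sup>2 \<le> 1 - p * y - ((p + p\<^sup>2) / 2 - \<delta>) * y\<^sup>2"
    by (auto simp: eventually_at dist_real_def)
  show ?thesis
  proof (rule that[of "min (d / 2) (1 / 2)"])
    fix y :: real assume y: "\<bar>y\<bar> \<le> min (d / 2) (1 / 2)"
    show "(1 + y) powr (p - 2) \<le> 1 + \<delta>"
      using bd[of y] y d assms by (cases "y = 0") auto
    show "(1 + y) powr p * (1 - p * y)\<^sup>2 \<le> 1 - p * y - ((p + p\<^sup>2) / 2 - \<delta>) * y\<^sup>2"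
      using bd[of y] y d assms by (cases "y = 0") auto
  qed (use d in auto)
qed

text \<open>The exponent \<open>1/q\<close> makes the \<open>L\<^sub>q\<close> constraint exact for every \<open>\<epsilon>\<close>.\<close>
definition test_radius :: "real \<Rightarrow> real \<Rightarrow> real \<Rightarrow> real"
  where "test_radius q \<epsilon> x = (1 + \<epsilon> * cos x) powr (1 / q)"

text \<open>
  The factor \<open>2/q\<close> makes \<open>r\<^sup>2 \<phi>'\<close>, with \<open>r\<close> the radius above, constant to first order in
  \<open>\<epsilon>\<close>; constancy of \<open>r\<^sup>2 \<phi>'\<close> is the Euler--Lagrange equation for the phase.
\<close>
definition test_phase :: "real \<Rightarrow> real \<Rightarrow> real \<Rightarrow> real \<Rightarrow> real"
  where "test_phase q \<alpha> \<epsilon> x = \<alpha> * (x - 2 / q * \<epsilon> * sin x)"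

lemma has_integral_period:
  fixes F :: "real \<Rightarrow> real"
  assumes "\<And>x. (F has_real_derivative f x) (at x)" "F (2 * pi) - F 0 = I"
  shows "(f has_integral I) {0..2 * pi}"
  using fundamental_theorem_of_calculus[of 0 "2 * pi" F f] assms
  by (auto simp: has_real_derivative_iff_has_vector_derivative
      intro: has_vector_derivative_at_within)

context
  fixes q \<alpha> \<epsilon> :: real
  assumes q: "q > 0" and \<epsilon>: "0 \<le> \<epsilon>" "\<epsilon> < 1"
begin

lemma one_plus_cos_pos: "1 + \<epsilon> * cos x > 0"
proof -
  have "\<bar>\<epsilon> * cos x\<bar> \<le> \<epsilon> * 1"
    unfolding abs_mult using \<epsilon> by (intro mult_mono) auto
  then show ?thesis using \<epsilon> by linarith
qed

lemma test_radius_deriv: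
  "(test_radius q \<epsilon> has_real_derivative
     - \<epsilon> * sin x / q * (1 + \<epsilon> * cos x) powr (1 / q - 1)) (at x)"
  unfolding test_radius_def[abs_def] using one_plus_cos_pos[of x]
  by (auto intro!: derivative_eq_intros simp: powr_diff field_simps)

lemma test_phase_deriv:
  "(test_phase q \<alpha> \<epsilon> has_real_derivative \<alpha> * (1 - 2 / q * (\<epsilon> * cos x))) (at x)"
  unfolding test_phase_def[abs_def] using q
  by (auto intro!: derivative_eq_intros simp: field_simps)

lemma test_radius_pos: "test_radius q \<epsilon> x > 0"
  using one_plus_cos_pos[of x] by (simp add: test_radius_def)

lemma continuous_test_derivs:
  "continuous_on S (\<lambda>x. - \<epsilon> * sin x / q * (1 + \<epsilon> * cos x) powr (1 / q - 1))"
  "continuous_on S (\<lambda>x. \<alpha> * (1 - 2 / q * (\<epsilon> * cos x)))"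
  using one_plus_cos_pos q by (auto intro!: continuous_intros simp: less_imp_neq[symmetric])

lemma test_radius_normalized:
  "has_bochner_integral period_measure (\<lambda>x. test_radius q \<epsilon> x powr q) (2 * pi)"
proof -
  have eq: "(\<lambda>x. test_radius q \<epsilon> x powr q) = (\<lambda>x. 1 + \<epsilon> * cos x)"
    using one_plus_cos_pos q by (auto simp: test_radius_def powr_powr less_imp_le)
  show ?thesis unfolding eq
    by (rule has_bochner_integral_lebesgue_on_continuous)
      (auto intro!: continuous_intros derivative_eq_intros
         has_integral_period[of "\<lambda>x. x + \<epsilon> * sin x"])
qed

lemma test_pair_admissible: "admissible q \<alpha> (test_radius q \<epsilon>) (test_phase q \<alpha> \<epsilon>)"
proof -
  have "absolutely_continuous_on {a..b} (test_radius q \<epsilon>)" for a b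
    using test_radius_deriv continuous_test_derivs(1)
    by (intro absolutely_continuous_on_C1)
      (auto simp: has_real_derivative_iff_has_vector_derivative)
  moreover have "absolutely_continuous_on {a..b} (test_phase q \<alpha> \<epsilon>)" for a b
    using test_phase_deriv continuous_test_derivs(2)
    by (intro absolutely_continuous_on_C1)
      (auto simp: has_real_derivative_iff_has_vector_derivative)
  moreover have "deriv (test_phase q \<alpha> \<epsilon>) = (\<lambda>x. \<alpha> * (1 - 2 / q * (\<epsilon> * cos x)))"
    using DERIV_imp_deriv[OF test_phase_deriv] by auto
  moreover have "has_bochner_integral period_measure (\<lambda>x. \<alpha> * (1 - 2 / q * (\<epsilon> * cos x))) (2 * pi * \<alpha>)"
    using test_phase_deriv
    by (intro has_bochner_integral_lebesgue_on_continuous continuous_test_derivs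
        has_integral_period) (auto simp: test_phase_def)
  ultimately show ?thesis
    using test_radius_pos test_radius_normalized
    by (auto simp: admissible_def periodic_2pi_def test_radius_def locally_absolutely_continuous_def)
qed

text \<open>
  The two hypotheses are the bounds of \<open>energy_density_expansion\<close> for \<open>p = 2/q\<close>. They bound
  the energy density by a trigonometric polynomial, which is integrated exactly; the coefficient
  of \<open>\<epsilon>\<^sup>2\<close> comes from \<open>1/q\<^sup>2 - \<alpha>\<^sup>2 (p + p\<^sup>2)/2 = (1 - (q+2)\<alpha>\<^sup>2)/q\<^sup>2\<close>.
\<close>
lemma J_test_pair_le:
  assumes "\<And>y. \<bar>y\<bar> \<le> \<epsilon> \<Longrightarrow> (1 + y) powr (2 / q - 2) \<le> 1 + \<delta>"
    and "\<And>y. \<bar>y\<bar> \<le> \<epsilon> \<Longrightarrow>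
      (1 + y) powr (2 / q) * (1 - 2 / q * y)\<^sup>2 \<le> 1 - 2 / q * y - ((2 / q + (2 / q)\<^sup>2) / 2 - \<delta>) * y\<^sup>2"
  shows "J (test_radius q \<epsilon>) (test_phase q \<alpha> \<epsilon>)
    \<le> ennreal (2 * pi * \<alpha>\<^sup>2 + pi * \<epsilon>\<^sup>2 * ((1 - (q + 2) * \<alpha>\<^sup>2) / q\<^sup>2 + \<delta> * (1 / q\<^sup>2 + \<alpha>\<^sup>2)))"
proof -
  define K where "K = (2 / q + (2 / q)\<^sup>2) / 2 - \<delta>"
  define g where "g = (\<lambda>x. (1 + \<delta>) / q\<^sup>2 * \<epsilon>\<^sup>2 * (sin x)\<^sup>2
     + \<alpha>\<^sup>2 * (1 - 2 / q * (\<epsilon> * cos x) - K * (\<epsilon> * cos x)\<^sup>2))"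
  have le: "(deriv (test_radius q \<epsilon>) x)\<^sup>2 + (test_radius q \<epsilon> x)\<^sup>2 * (deriv (test_phase q \<alpha> \<epsilon>) x)\<^sup>2 \<le> g x"
    (is "?L \<le> _") for x
  proof -
    let ?y = "\<epsilon> * cos x"
    have y: "\<bar>?y\<bar> \<le> \<epsilon>"
      unfolding abs_mult using \<epsilon> mult_left_mono[of "\<bar>cos x\<bar>" 1 \<epsilon>] by auto
    have sq: "((1 + ?y) powr a)\<^sup>2 = (1 + ?y) powr (2 * a)" for a
      using one_plus_cos_pos[of x] by (simp add: power2_eq_square powr_add[symmetric])
    have "?L = \<epsilon>\<^sup>2 * (sin x)\<^sup>2 / q\<^sup>2 * (1 + ?y) powr (2 / q - 2)
        + \<alpha>\<^sup>2 * ((1 + ?y) powr (2 / q) * (1 - 2 / q * ?y)\<^sup>2)"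
      unfolding DERIV_imp_deriv[OF test_radius_deriv] DERIV_imp_deriv[OF test_phase_deriv]
      by (simp add: power_mult_distrib power_divide sq test_radius_def algebra_simps
          flip: power_mult_distrib[of \<alpha>])
    also have "\<dots> \<le> \<epsilon>\<^sup>2 * (sin x)\<^sup>2 / q\<^sup>2 * (1 + \<delta>) + \<alpha>\<^sup>2 * (1 - 2 / q * ?y - K * ?y\<^sup>2)"
      unfolding K_def using assms y by (intro add_mono mult_left_mono) auto
    also have "\<dots> = g x" by (simp add: g_def)
    finally show ?thesis .
  qed
  define I where "I = 2 * pi * \<alpha>\<^sup>2 + pi * \<epsilon>\<^sup>2 * ((1 + \<delta>) / q\<^sup>2 - \<alpha>\<^sup>2 * K)"
  have "(g has_integral I) {0..2 * pi}"
  proof (rule has_integral_period)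
    let ?G = "\<lambda>x. (1 + \<delta>) / q\<^sup>2 * \<epsilon>\<^sup>2 * ((x - sin x * cos x) / 2)
       + \<alpha>\<^sup>2 * (x - 2 / q * (\<epsilon> * sin x) - K * \<epsilon>\<^sup>2 * ((x + sin x * cos x) / 2))"
    have sc: "cos x * cos x = 1 - sin x * sin x" for x :: real
      using cos_squared_eq[of x] by (simp only: power2_eq_square)
    have sin: "((\<lambda>x. (x - sin x * cos x) / 2) has_real_derivative (sin x)\<^sup>2) (at x)" for x :: real
      by (auto intro!: derivative_eq_intros simp: power2_eq_square sc)
    have cos: "((\<lambda>x. (x + sin x * cos x) / 2) has_real_derivative (cos x)\<^sup>2) (at x)" for x :: real
      by (auto intro!: derivative_eq_intros simp: power2_eq_square sc)
    show "(?G has_real_derivative g x) (at x)" for x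
      by (rule sin cos DERIV_add DERIV_diff DERIV_cmult DERIV_ident DERIV_sin DERIV_cong)+
        (simp add: g_def power_mult_distrib mult.assoc)
    show "?G (2 * pi) - ?G 0 = I" by (simp add: I_def algebra_simps)
  qed
  then have bi: "has_bochner_integral period_measure g I"
    by (intro has_bochner_integral_lebesgue_on_continuous) (use q in \<open>auto simp: g_def intro!: continuous_intros\<close>)
  have "0 \<le> g x" for x by (rule order_trans[OF _ le]) simp
  then have "(\<integral>\<^sup>+x. ennreal (g x) \<partial>period_measure) = ennreal I"
    using bi by (subst nn_integral_eq_integral) (auto simp: has_bochner_integral_iff)
  moreover have "J (test_radius q \<epsilon>) (test_phase q \<alpha> \<epsilon>) \<le> (\<integral>\<^sup>+x. ennreal (g x) \<partial>period_measure)"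
    unfolding J_def by (intro nn_integral_mono ennreal_leI le)
  moreover have "I = 2 * pi * \<alpha>\<^sup>2 + pi * \<epsilon>\<^sup>2 * ((1 - (q + 2) * \<alpha>\<^sup>2) / q\<^sup>2 + \<delta> * (1 / q\<^sup>2 + \<alpha>\<^sup>2))"
  proof -
    have "(1 + \<delta>) / q\<^sup>2 - \<alpha>\<^sup>2 * K = (1 - (q + 2) * \<alpha>\<^sup>2) / q\<^sup>2 + \<delta> * (1 / q\<^sup>2 + \<alpha>\<^sup>2)"
      using q by (simp add: K_def field_simps power2_eq_square)
    then show ?thesis by (simp add: I_def)
  qed
  ultimately show ?thesis by simp
qed

end

section \<open>Energy below the constant radius\<close>

lemma exists_lower_energy_test_pair:
  fixes q \<alpha> :: real
  assumes q: "q > 0" and gt: "(q + 2) * \<alpha>\<^sup>2 > 1"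
  obtains \<epsilon> B where "0 \<le> \<epsilon>" "\<epsilon> < 1" "0 \<le> B" "B < 2 * pi * \<alpha>\<^sup>2"
    "J (test_radius q \<epsilon>) (test_phase q \<alpha> \<epsilon>) \<le> ennreal B"
proof -
  define c where "c = ((q + 2) * \<alpha>\<^sup>2 - 1) / q\<^sup>2"
  \<comment> \<open>The error term \<open>\<delta> (1/q\<^sup>2 + \<alpha>\<^sup>2)\<close> uses up half of the second-order gain \<open>c\<close>.\<close>
  define \<delta> where "\<delta> = c / (2 * (1 / q\<^sup>2 + \<alpha>\<^sup>2))"
  have c: "c > 0" using q gt by (simp add: c_def)
  have d: "1 / q\<^sup>2 + \<alpha>\<^sup>2 > 0" using q by (simp add: add_pos_nonneg)
  have \<delta>: "\<delta> > 0" "\<delta> * (1 / q\<^sup>2 + \<alpha>\<^sup>2) = c / 2"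
    unfolding \<delta>_def using c d by (auto simp: nonzero_divide_mult_cancel_right simp del: distrib_left_numeral)
  obtain \<epsilon> where \<epsilon>: "0 < \<epsilon>" "\<epsilon> < 1"
    "\<And>y. \<bar>y\<bar> \<le> \<epsilon> \<Longrightarrow> (1 + y) powr (2 / q - 2) \<le> 1 + \<delta>"
    "\<And>y. \<bar>y\<bar> \<le> \<epsilon> \<Longrightarrow> (1 + y) powr (2 / q) * (1 - 2 / q * y)\<^sup>2
       \<le> 1 - 2 / q * y - ((2 / q + (2 / q)\<^sup>2) / 2 - \<delta>) * y\<^sup>2"
    using energy_density_expansion[OF \<delta>(1), of "2 / q"] by blast
  define A where "A = 2 * pi * \<alpha>\<^sup>2 - pi * \<epsilon>\<^sup>2 * (c / 2)"
  have "(1 - (q + 2) * \<alpha>\<^sup>2) / q\<^sup>2 = - c" by (simp add: c_def diff_divide_distrib)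
  then have "J (test_radius q \<epsilon>) (test_phase q \<alpha> \<epsilon>) \<le> ennreal A"
    using J_test_pair_le[OF q _ \<epsilon>(2-4), of \<alpha>] \<epsilon>(1) by (simp add: \<delta>(2) A_def)
  \<comment> \<open>The truncation at 0 supplies the nonnegativity of \<open>B\<close>, which its square root needs later.\<close>
  moreover have "ennreal A = ennreal (max 0 A)" by (simp add: max_def ennreal_neg)
  moreover have "\<alpha> \<noteq> 0" using gt by auto
  then have "max 0 A < 2 * pi * \<alpha>\<^sup>2" using c \<epsilon> by (simp add: A_def)
  ultimately show ?thesis using \<epsilon> by (intro that[of \<epsilon> "max 0 A"]) auto
qed

theorem theorem2p1:
  fixes q \<alpha> :: real
  assumes "2 < q" and "\<bar>\<alpha>\<bar> \<le> 1 / 2" and "(q + 2) * \<alpha>\<^sup>2 > 1"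
  shows "\<not> (\<exists>\<phi>. J_minimizer q \<alpha> (\<lambda>x. 1) \<phi>) \<and>
    mu q \<alpha> < ennreal ((2 * pi) powr (1 / 2 - 1 / q) * \<bar>\<alpha>\<bar>)"
proof -
  have q: "q > 0" using assms(1) by simp
  obtain \<epsilon> B where \<epsilon>: "0 \<le> \<epsilon>" "\<epsilon> < 1" and B: "0 \<le> B" "B < 2 * pi * \<alpha>\<^sup>2"
    and J: "J (test_radius q \<epsilon>) (test_phase q \<alpha> \<epsilon>) \<le> ennreal B"
    using exists_lower_energy_test_pair[OF q assms(3)] by blast
  note adm = test_pair_admissible[OF q \<epsilon>, of \<alpha>]
  have "\<not> J_minimizer q \<alpha> (\<lambda>x. 1) \<phi>" for \<phi>
  proof
    assume min: "J_minimizer q \<alpha> (\<lambda>x. 1) \<phi>"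
    then have "ennreal (2 * pi * \<alpha>\<^sup>2) \<le> J (\<lambda>x. 1) \<phi>"
      by (intro J_unit_radius_ge) (auto simp: J_minimizer_def admissible_def)
    also have "\<dots> \<le> J (test_radius q \<epsilon>) (test_phase q \<alpha> \<epsilon>)"
      using min adm by (auto simp: J_minimizer_def)
    also note J
    also have "ennreal B < ennreal (2 * pi * \<alpha>\<^sup>2)" using B by (intro ennreal_lessI) auto
    finally show False by simp
  qed
  moreover have "mu q \<alpha> < ennreal ((2 * pi) powr (1 / 2 - 1 / q) * \<bar>\<alpha>\<bar>)"
  proof -
    have "mu q \<alpha> \<le> ennreal (sqrt B / (2 * pi) powr (1 / q))"
    proof (rule mu_le_of_polar_pair)
      show "test_phase q \<alpha> \<epsilon> (x + 2 * pi) = test_phase q \<alpha> \<epsilon> x + 2 * pi * \<alpha>" for x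
        using sin_periodic[of x] by (simp add: test_phase_def algebra_simps del: sin_periodic)
    qed (use q adm J B test_radius_deriv[OF q \<epsilon>] test_phase_deriv[OF q \<epsilon>]
        continuous_test_derivs[OF q \<epsilon>] in \<open>auto simp: admissible_def\<close>)
    also have "\<dots> < ennreal ((2 * pi) powr (1 / 2 - 1 / q) * \<bar>\<alpha>\<bar>)"
    proof (rule ennreal_lessI)
      have "sqrt B < sqrt (2 * pi * \<alpha>\<^sup>2)" using B by simp
      also have "\<dots> = (2 * pi) powr (1 / 2) * \<bar>\<alpha>\<bar>" by (simp add: real_sqrt_mult powr_half_sqrt)
      finally show "sqrt B / (2 * pi) powr (1 / q) < (2 * pi) powr (1 / 2 - 1 / q) * \<bar>\<alpha>\<bar>"
        by (simp add: powr_diff divide_strict_right_mono)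
      have "\<alpha> \<noteq> 0" using assms(3) by auto
      then show "0 < (2 * pi) powr (1 / 2 - 1 / q) * \<bar>\<alpha>\<bar>" by simp
    qed
    finally show ?thesis .
  qed
  ultimately show ?thesis by blast
qed

end
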